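(* Let $c = 5.01$ (more generally, $c$ may be any constant larger than $5$). There are constants $C, a > 0$ depending only on $c$ such that the following holds for all integers $n, d \ge 1$ and all reals $L > 0$, $R > 0$, $\epsilon \ge 0$, $\tau > 0$, $B_0 \ge 0$, $\delta \in (0,1)$ with $\tau \ge c\, \epsilon R$. There is a randomized server algorithm that, on every $R$-instance of the DLAGP problem with these parameters satisfying $\max_{1 \le i \le n} \|\nabla \ell_i(\mathbf{0})\| = B_0$, and for all valid client replies, issues at most $$C \cdot \frac{L R^4 (B_0 + L R)^2}{\tau^3} \cdot \Bigl(\log\bigl(2 + L + R + \tfrac1\tau + \tfrac1\delta\bigr)\Bigr)^{a}$$ approximate gradient queries and, with probability at least $1-\delta$, outputs a vector $w \in \mathbb{R}^d$ with $f(w) - f(w^* ) \le \tau$. Moreover, in this algorithm the client of every query is selected uniformly at random from $\{1,\dots,n\}$.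
   Context: All norms are Euclidean. A differentiable function is $L$-smooth if its gradient is $L$-Lipschitz. DLAGP problem: there are $n$ clients; client $i \in \{1,\dots,n\}$ holds a convex, $L$-smooth function $\ell_i : \mathbb{R}^d \to \mathbb{R}$. Let $f(w) = \frac1n \sum_{i=1}^n \ell_i(w)$, assumed to attain its minimum; $w^*$ denotes a minimizer of $f$ of smallest norm. An $R$-instance is an instance with $\|w^*\| \le R$, where $R$ is known to the server. The server knows $n, d, L, R, \epsilon, \tau, \delta, B_0$, and obtains further information about the $\ell_i$ only through approximate gradient queries: the server (adaptively, possibly using random choices) selects $i \in \{1,\dots,n\}$ and $w \in \mathbb{R}^d$, and client $i$ replies with a vector $v$ satisfying $\|v - \nabla \ell_i(w)\| \le \epsilon$. The reply may be an arbitrary (adversarially chosen) vector satisfying this inequality, possibly depending on the interaction so far but not on the server's future random choices; such replies are called valid. *)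

theory Defs
  imports
    "HOL-Probability.Probability"
    "HOL-Library.Poly_Mapping"
begin

text \<open>
  The constants of the theorem must not depend on the dimension \<open>d\<close>, so \<open>d\<close> is quantified inside the
  statement and cannot be a type.  All spaces \<open>\<real>\<^sup>d\<close> are therefore taken as the coordinate subspaces
  of one inner product space, the finitely supported real sequences with the Euclidean inner product.
\<close>

instantiation poly_mapping :: (type, real_vector) real_vector
begin

definition scaleR_poly_mapping :: "real \<Rightarrow> ('a \<Rightarrow>\<^sub>0 'b) \<Rightarrow> ('a \<Rightarrow>\<^sub>0 'b)"
  where "scaleR_poly_mapping r x = Poly_Mapping.map (\<lambda>v. r *\<^sub>R v) x"

lemma lookup_scaleR:
  fixes x :: "'a \<Rightarrow>\<^sub>0 'b"
  shows "Poly_Mapping.lookup (r *\<^sub>R x) k = r *\<^sub>R Poly_Mapping.lookup x k"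
  by (simp add: scaleR_poly_mapping_def Poly_Mapping.map.rep_eq when_def)

instance
  by standard
    (auto intro!: poly_mapping_eqI simp: lookup_scaleR lookup_add scaleR_add_right scaleR_add_left)

end

instantiation poly_mapping :: (type, real_inner) real_inner
begin

definition inner_poly_mapping :: "('a \<Rightarrow>\<^sub>0 'b) \<Rightarrow> ('a \<Rightarrow>\<^sub>0 'b) \<Rightarrow> real"
  where "inner_poly_mapping x y =
    (\<Sum>k\<in>Poly_Mapping.keys x. Poly_Mapping.lookup x k \<bullet> Poly_Mapping.lookup y k)"

definition norm_poly_mapping :: "('a \<Rightarrow>\<^sub>0 'b) \<Rightarrow> real"
  where "norm_poly_mapping x = sqrt (x \<bullet> x)"

definition dist_poly_mapping :: "('a \<Rightarrow>\<^sub>0 'b) \<Rightarrow> ('a \<Rightarrow>\<^sub>0 'b) \<Rightarrow> real"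
  where "dist_poly_mapping x y = norm (x - y)"

definition sgn_poly_mapping :: "('a \<Rightarrow>\<^sub>0 'b) \<Rightarrow> ('a \<Rightarrow>\<^sub>0 'b)"
  where "sgn_poly_mapping x = x /\<^sub>R norm x"

definition uniformity_poly_mapping :: "(('a \<Rightarrow>\<^sub>0 'b) \<times> ('a \<Rightarrow>\<^sub>0 'b)) filter"
  where "uniformity_poly_mapping = (INF e\<in>{0<..}. principal {(x, y). dist x y < e})"

definition open_poly_mapping :: "('a \<Rightarrow>\<^sub>0 'b) set \<Rightarrow> bool"
  where "open_poly_mapping U \<longleftrightarrow> (\<forall>x\<in>U. eventually (\<lambda>(x', y). x' = x \<longrightarrow> y \<in> U) uniformity)"

lemma inner_poly_mapping_superset:
  fixes x y :: "'a \<Rightarrow>\<^sub>0 'b"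
  assumes "finite K" "Poly_Mapping.keys x \<subseteq> K"
  shows "x \<bullet> y = (\<Sum>k\<in>K. Poly_Mapping.lookup x k \<bullet> Poly_Mapping.lookup y k)"
  unfolding inner_poly_mapping_def
  by (rule sum.mono_neutral_left) (use assms in \<open>auto simp: in_keys_iff\<close>)

instance
proof
  fix x y z :: "'a \<Rightarrow>\<^sub>0 'b" and r :: real
  let ?K = "Poly_Mapping.keys x \<union> Poly_Mapping.keys y"
  show "x \<bullet> y = y \<bullet> x"
    by (simp add: inner_poly_mapping_superset[of ?K] inner_commute)
  show "(x + y) \<bullet> z = x \<bullet> z + y \<bullet> z"
    using keys_add[of x y]
    by (simp add: inner_poly_mapping_superset[of ?K] lookup_add inner_add_left sum.distrib)
  have "Poly_Mapping.keys (r *\<^sub>R x) \<subseteq> Poly_Mapping.keys x"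
    by (auto simp: in_keys_iff lookup_scaleR)
  then show "(r *\<^sub>R x) \<bullet> y = r * (x \<bullet> y)"
    by (simp add: inner_poly_mapping_superset[of "Poly_Mapping.keys x"] lookup_scaleR sum_distrib_left)
  show "0 \<le> x \<bullet> x"
    by (simp add: inner_poly_mapping_def sum_nonneg)
  show "x \<bullet> x = 0 \<longleftrightarrow> x = 0"
    by (auto simp: inner_poly_mapping_def sum_nonneg_eq_0_iff in_keys_iff intro!: poly_mapping_eqI)
qed (rule norm_poly_mapping_def dist_poly_mapping_def sgn_poly_mapping_def
       uniformity_poly_mapping_def open_poly_mapping_def)+

end

type_synonym rvec = "nat \<Rightarrow>\<^sub>0 real"

definition Rn :: "nat \<Rightarrow> rvec set"
  where "Rn d = {x. Poly_Mapping.keys x \<subseteq> {..<d}}"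

lemma inner_Rn:
  "x \<in> Rn d \<Longrightarrow> x \<bullet> y = (\<Sum>k<d. Poly_Mapping.lookup x k * Poly_Mapping.lookup y k)"
  by (simp add: Rn_def inner_poly_mapping_superset[of "{..<d}"])

lemma subspace_Rn: "subspace (Rn d)"
proof (rule subspaceI)
  fix x y :: rvec and c :: real
  assume x: "x \<in> Rn d"
  show "c *\<^sub>R x \<in> Rn d"
    using x by (auto simp: Rn_def in_keys_iff lookup_scaleR subset_iff)
  assume "y \<in> Rn d"
  then show "x + y \<in> Rn d"
    using x keys_add[of x y] by (auto simp: Rn_def)
qed (simp add: Rn_def)


section \<open>Gradients and smoothness on \<open>\<real>\<^sup>d\<close>\<close>

text \<open>
  A function \<open>\<real>\<^sup>d \<rightarrow> \<real>\<close> is a total function on \<^typ>\<open>rvec\<close> of which only the values on \<^term>\<open>Rn d\<close>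
  matter; hence derivatives are taken within \<^term>\<open>Rn d\<close>.
\<close>

definition has_gradient :: "nat \<Rightarrow> (rvec \<Rightarrow> real) \<Rightarrow> rvec \<Rightarrow> rvec \<Rightarrow> bool"
  where "has_gradient d f w g \<longleftrightarrow>
    g \<in> Rn d \<and> (f has_derivative (\<lambda>h. g \<bullet> h)) (at w within Rn d)"

lemma has_gradient_unique:
  assumes "has_gradient d f w g" "has_gradient d f w g'" "w \<in> Rn d"
  shows "g = g'"
proof -
  define u where "u = g - g'"
  have u: "u \<in> Rn d"
    using assms subspace_diff[OF subspace_Rn] by (auto simp: has_gradient_def u_def)
  have line: "((\<lambda>t. f (w + t *\<^sub>R u)) has_real_derivative (g \<bullet> u)) (at 0)"
    if "has_gradient d f w g" for g
  proof -
    have sub: "range (\<lambda>t. w + t *\<^sub>R u) \<subseteq> Rn d"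
      using u assms(3) by (auto intro: subspace_add subspace_scale subspace_Rn)
    have "(f has_derivative (\<lambda>h. g \<bullet> h)) (at (w + 0 *\<^sub>R u) within range (\<lambda>t. w + t *\<^sub>R u))"
      using that sub by (auto simp: has_gradient_def intro: has_derivative_subset)
    moreover have "((\<lambda>t. w + t *\<^sub>R u) has_derivative (\<lambda>t. t *\<^sub>R u)) (at 0)"
      by (auto intro!: derivative_eq_intros)
    ultimately have "((\<lambda>t. f (w + t *\<^sub>R u)) has_derivative (\<lambda>t. g \<bullet> (t *\<^sub>R u))) (at 0)"
      by (rule has_derivative_in_compose[rotated])
    then show ?thesis
      by (simp add: has_field_derivative_def mult_commute_abs)
  qed
  have "g \<bullet> u = g' \<bullet> u"
    using line[OF assms(1)] line[OF assms(2)] by (rule DERIV_unique)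
  then have "u \<bullet> u = 0"
    by (simp add: u_def inner_diff_left)
  then show ?thesis
    by (simp add: u_def)
qed

definition gradient :: "nat \<Rightarrow> (rvec \<Rightarrow> real) \<Rightarrow> rvec \<Rightarrow> rvec"
  where "gradient d f w = (THE g. has_gradient d f w g)"

definition smooth_with :: "nat \<Rightarrow> real \<Rightarrow> (rvec \<Rightarrow> real) \<Rightarrow> bool"
  where "smooth_with d L f \<longleftrightarrow>
    f differentiable_on Rn d \<and> L-lipschitz_on (Rn d) (gradient d f)"


section \<open>The DLAGP problem\<close>

definition objective :: "nat \<Rightarrow> (nat \<Rightarrow> rvec \<Rightarrow> real) \<Rightarrow> rvec \<Rightarrow> real"
  where "objective n l w = (1 / real n) * (\<Sum>i=1..n. l i w)"

definition minimizer :: "nat \<Rightarrow> (rvec \<Rightarrow> real) \<Rightarrow> rvec \<Rightarrow> bool"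
  where "minimizer d f = is_arg_min f (\<lambda>w. w \<in> Rn d)"

definition least_norm_minimizer :: "nat \<Rightarrow> (rvec \<Rightarrow> real) \<Rightarrow> rvec \<Rightarrow> bool"
  where "least_norm_minimizer d f = is_arg_min norm (minimizer d f)"

definition R_instance ::
    "nat \<Rightarrow> nat \<Rightarrow> real \<Rightarrow> real \<Rightarrow> (nat \<Rightarrow> rvec \<Rightarrow> real) \<Rightarrow> rvec \<Rightarrow> bool"
  where "R_instance n d L R l wstar \<longleftrightarrow>
    (\<forall>i\<in>{1..n}. convex_on (Rn d) (l i) \<and> smooth_with d L (l i)) \<and>
    least_norm_minimizer d (objective n l) wstar \<and> norm wstar \<le> R"


section \<open>Servers, client replies and their interaction\<close>

datatype action = Query nat rvec | Output rvec

text \<open>The queries (client, point) made so far, in chronological order, with the replies received.\<close>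
type_synonym transcript = "(nat \<times> rvec \<times> rvec) list"

text \<open>
  A randomized server draws its next action from a distribution depending on the transcript.
  Distributions are discrete, so that client replies need not depend measurably on the transcript.
\<close>
type_synonym server = "transcript \<Rightarrow> action pmf"

definition server_for :: "nat \<Rightarrow> nat \<Rightarrow> server \<Rightarrow> bool"
  where "server_for n d S \<longleftrightarrow>
    (\<forall>h. set_pmf (S h) \<subseteq> {Query i w | i w. i \<in> {1..n} \<and> w \<in> Rn d} \<union> Output ` Rn d)"

text \<open>
  Given the past and the query point, each client is selected with the same probability.
\<close>
definition selects_clients_uniformly :: "nat \<Rightarrow> server \<Rightarrow> bool"
  where "selects_clients_uniformly n S \<longleftrightarrow>
    (\<forall>h w. \<forall>i\<in>{1..n}. \<forall>j\<in>{1..n}. pmf (S h) (Query i w) = pmf (S h) (Query j w))"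

text \<open>A reply depends on the preceding transcript and on the current query.\<close>
type_synonym replies = "transcript \<Rightarrow> nat \<Rightarrow> rvec \<Rightarrow> rvec"

definition valid_replies ::
    "nat \<Rightarrow> nat \<Rightarrow> real \<Rightarrow> (nat \<Rightarrow> rvec \<Rightarrow> real) \<Rightarrow> replies \<Rightarrow> bool"
  where "valid_replies n d \<epsilon> l A \<longleftrightarrow>
    (\<forall>h. \<forall>i\<in>{1..n}. \<forall>w\<in>Rn d. A h i w \<in> Rn d \<and> norm (A h i w - gradient d (l i) w) \<le> \<epsilon>)"

text \<open>
  \<open>run S A k h\<close> continues the interaction after transcript \<open>h\<close>, with at most \<open>k\<close> further queries.
  The result is \<^term>\<open>None\<close> if the server attempts a further query after these.
\<close>
primrec run :: "server \<Rightarrow> replies \<Rightarrow> nat \<Rightarrow> transcript \<Rightarrow> rvec option pmf" where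
  "run S A 0 h =
    map_pmf (\<lambda>a. case a of Output w \<Rightarrow> Some w | Query i w \<Rightarrow> None) (S h)"
| "run S A (Suc k) h =
    bind_pmf (S h) (\<lambda>a. case a of
      Output w \<Rightarrow> return_pmf (Some w)
    | Query i w \<Rightarrow> run S A k (h @ [(i, w, A h i w)]))"

definition issues_at_most :: "server \<Rightarrow> replies \<Rightarrow> nat \<Rightarrow> bool"
  where "issues_at_most S A k \<longleftrightarrow> None \<notin> set_pmf (run S A k [])"

end

theory Submission
  imports Defs
begin

text \<open>
  If \<open>L R\<^sup>2 \<le> \<tau>\<close>, then \<open>w = 0\<close> is already good enough, since the gradient of \<open>f\<close> at \<open>w\<^sup>*\<close> vanishes and
  is \<open>L\<close>-Lipschitz; no query is needed.  Otherwise \<open>5 \<epsilon> R \<le> \<tau>\<close> gives \<open>\<epsilon> \<le> L R\<close>, all replies on the ball of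
  radius \<open>R\<close> have norm at most \<open>G = 2 (B\<^sub>0 + L R)\<close>, and stochastic gradient descent projected onto that
  ball succeeds.  An adversarial error costs at most \<open>\<epsilon> \<cdot> 2R \<le> 2\<tau>/5\<close> per step, the optimization error is at
  most \<open>\<tau>/5\<close> per step after \<open>T\<close> of order \<open>(R G / \<tau>)\<^sup>2\<close> steps, and the differences between
  \<open>f(w) - f(w\<^sup>*)\<close> and the sampled client's \<open>\<ell>\<^sub>i(w) - \<ell>\<^sub>i(w\<^sup>*)\<close> are bounded martingale increments
  whatever the replies, so that they average to at most \<open>2\<tau>/5\<close> with probability \<open>1 - \<delta>\<close> as soon as
  \<open>T \<ge> 50 (R G / \<tau>)\<^sup>2 (1 + ln (1/\<delta>))\<close>.  The claimed budget is larger by the factor \<open>L R\<^sup>2 / \<tau> > 1\<close>.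
\<close>

section \<open>Gradients of convex functions\<close>

text \<open>
  \<^typ>\<open>rvec\<close> is infinite-dimensional and not complete, so the representing vector is assembled from the
  coordinates below \<open>d\<close> instead of being taken from a Riesz theorem.
\<close>
lemma has_gradient_gradient:
  assumes "f differentiable_on Rn d" "w \<in> Rn d"
  shows "has_gradient d f w (gradient d f w)"
proof -
  obtain f' where f': "(f has_derivative f') (at w within Rn d)"
    using assms by (auto simp: differentiable_on_def differentiable_def)
  then interpret f': bounded_linear f'
    by (rule has_derivative_bounded_linear)
  define e where "e k = Poly_Mapping.single k (1::real)" for k :: nat
  define g where "g = (\<Sum>k<d. f' (e k) *\<^sub>R e k)"
  have e_lookup: "Poly_Mapping.lookup (e k) j = (if j = k then 1 else 0)" for k j
    by (simp add: e_def lookup_single when_def)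
  have e_Rn: "k < d \<Longrightarrow> e k \<in> Rn d" for k
    by (simp add: e_def Rn_def)
  have g_lookup: "Poly_Mapping.lookup g j = f' (e j)" if "j < d" for j
    using that by (simp add: g_def lookup_sum lookup_scaleR e_lookup if_distrib[of "\<lambda>x. _ * x"] cong: if_cong)
  have g_Rn: "g \<in> Rn d"
    unfolding g_def by (intro subspace_sum[OF subspace_Rn] subspace_scale[OF subspace_Rn] e_Rn) auto
  have eq: "f' h = g \<bullet> h" if "h \<in> Rn d" for h
  proof -
    have "h = (\<Sum>k<d. Poly_Mapping.lookup h k *\<^sub>R e k)"
      using that
      by (intro poly_mapping_eqI)
        (auto simp: Rn_def lookup_sum lookup_scaleR e_lookup in_keys_iff subset_iff
           if_distrib[of "\<lambda>x. _ * x"] cong: if_cong)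
    then have "f' h = f' (\<Sum>k<d. Poly_Mapping.lookup h k *\<^sub>R e k)"
      by simp
    also have "\<dots> = g \<bullet> h"
      using inner_Rn[OF g_Rn, of h] by (simp add: f'.sum f'.scaleR g_lookup mult.commute)
    finally show ?thesis .
  qed
  have "(f has_derivative (\<lambda>h. g \<bullet> h)) (at w within Rn d)"
    unfolding has_derivative_within
  proof
    show "bounded_linear ((\<bullet>) g)"
      by (rule bounded_linear_inner_right)
    have "((\<lambda>y. (1 / norm (y - w)) *\<^sub>R (f y - (f w + f' (y - w)))) \<longlongrightarrow> 0) (at w within Rn d)"
      using f' by (simp add: has_derivative_within)
    \<comment> \<open>\<open>f'\<close> and \<open>g\<close> agree only on \<open>Rn d\<close>,
      which suffices because increments \<open>y - w\<close> within \<open>Rn d\<close> stay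
      there.\<close>
    moreover have "\<forall>\<^sub>F y in at w within Rn d.
        (1 / norm (y - w)) *\<^sub>R (f y - (f w + f' (y - w))) =
        (1 / norm (y - w)) *\<^sub>R (f y - (f w + g \<bullet> (y - w)))"
      using assms(2) subspace_diff[OF subspace_Rn] by (auto simp: eventually_at_filter eq)
    ultimately show "((\<lambda>y. (1 / norm (y - w)) *\<^sub>R (f y - (f w + g \<bullet> (y - w)))) \<longlongrightarrow> 0) (at w within Rn d)"
      by (rule Lim_transform_eventually)
  qed
  with g_Rn have "has_gradient d f w g"
    by (simp add: has_gradient_def)
  then show ?thesis
    unfolding gradient_def by (rule theI) (use has_gradient_unique assms(2) \<open>has_gradient d f w g\<close> in blast)
qed

lemma has_gradient_imp_DERIV_line:
  assumes "has_gradient d f w g" "w \<in> Rn d" "u \<in> Rn d"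
  shows "((\<lambda>t. f (w + t *\<^sub>R u)) has_real_derivative (g \<bullet> u)) (at 0)"
proof -
  have sub: "range (\<lambda>t. w + t *\<^sub>R u) \<subseteq> Rn d"
    using assms by (auto intro: subspace_add subspace_scale subspace_Rn)
  have "(f has_derivative (\<lambda>h. g \<bullet> h)) (at (w + 0 *\<^sub>R u) within range (\<lambda>t. w + t *\<^sub>R u))"
    using assms(1) sub by (auto simp: has_gradient_def intro: has_derivative_subset)
  moreover have "((\<lambda>t. w + t *\<^sub>R u) has_derivative (\<lambda>t. t *\<^sub>R u)) (at 0)"
    by (auto intro!: derivative_eq_intros)
  ultimately have "((\<lambda>t. f (w + t *\<^sub>R u)) has_derivative (\<lambda>t. g \<bullet> (t *\<^sub>R u))) (at 0)"
    by (rule has_derivative_in_compose[rotated])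
  then show ?thesis
    by (simp add: has_field_derivative_def mult_commute_abs)
qed

text \<open>Along the segment from \<open>w\<close> to \<open>z\<close> this is the tangent
  inequality for a convex function of one real variable, read between 0 and 1.\<close>

lemma convex_on_above_gradient:
  assumes "convex_on (Rn d) f" "has_gradient d f w g" "w \<in> Rn d" "z \<in> Rn d"
  shows "f z \<ge> f w + g \<bullet> (z - w)"
proof -
  define u where "u = z - w"
  have u: "u \<in> Rn d"
    using assms subspace_diff[OF subspace_Rn] by (simp add: u_def)
  have line_Rn: "w + t *\<^sub>R u \<in> Rn d" for t
    using assms(3) u by (auto intro: subspace_add subspace_scale subspace_Rn)
  have "convex_on UNIV (\<lambda>t. f (w + t *\<^sub>R u))"
  proof (rule convex_onI)
    fix t x y :: real
    assume "0 < t" "t < 1"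
    have "w + ((1 - t) *\<^sub>R x + t *\<^sub>R y) *\<^sub>R u = (1 - t) *\<^sub>R (w + x *\<^sub>R u) + t *\<^sub>R (w + y *\<^sub>R u)"
      by (simp add: algebra_simps)
    with convex_onD[OF assms(1), of t "w + x *\<^sub>R u" "w + y *\<^sub>R u"] \<open>0 < t\<close> \<open>t < 1\<close> line_Rn
    show "f (w + ((1 - t) *\<^sub>R x + t *\<^sub>R y) *\<^sub>R u) \<le> (1 - t) * f (w + x *\<^sub>R u) + t * f (w + y *\<^sub>R u)"
      by simp
  qed simp
  then have "f (w + 1 *\<^sub>R u) - f (w + 0 *\<^sub>R u) \<ge> (g \<bullet> u) * (1 - 0)"
    by (rule convex_on_imp_above_tangent)
      (use has_gradient_imp_DERIV_line[OF assms(2,3) u] in auto)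
  then show ?thesis
    by (simp add: u_def)
qed


section \<open>Projection onto a ball\<close>

definition ball_proj :: "real \<Rightarrow> 'a::real_normed_vector \<Rightarrow> 'a"
  where "ball_proj r x = (if norm x \<le> r then x else (r / norm x) *\<^sub>R x)"

lemma norm_ball_proj_le: "0 \<le> r \<Longrightarrow> norm (ball_proj r x) \<le> r"
  by (simp add: ball_proj_def)

text \<open>Outside the ball, with scaling factor \<open>s\<close>, Cauchy-Schwarz bounds
  \<open>(1 - s) * (x \<bullet> z)\<close>. Expanding both squares then shows that they differ by at
  least \<open>(norm x - r)\<^sup>2\<close>.\<close>

lemma norm_ball_proj_diff_le:
  fixes x z :: "'a::real_inner"
  assumes "norm z \<le> r"
  shows "norm (ball_proj r x - z) \<le> norm (x - z)"
proof (cases "norm x \<le> r")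
  case False
  define s where "s = r / norm x"
  have r0: "0 \<le> r"
    using assms norm_ge_zero order_trans by blast
  with False have nx: "0 < norm x"
    by linarith
  have s: "s * norm x = r" "0 \<le> s" "s \<le> 1"
    using False nx r0 by (auto simp: s_def)
  have "x \<bullet> z \<le> norm x * r"
    using norm_cauchy_schwarz[of x z] mult_left_mono[OF assms, of "norm x"] by simp
  then have "(1 - s) * (x \<bullet> z) \<le> (1 - s) * (norm x * r)"
    using s by (intro mult_left_mono) auto
  also have "\<dots> = norm x * r - r\<^sup>2"
    using s(1) by (simp add: algebra_simps power2_eq_square)
  finally have ip: "(1 - s) * (x \<bullet> z) \<le> norm x * r - r\<^sup>2" .
  have "(norm (s *\<^sub>R x - z))\<^sup>2 = (s * norm x)\<^sup>2 - 2 * (s * (x \<bullet> z)) + (norm z)\<^sup>2"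
    unfolding power_mult_distrib power2_norm_eq_inner
    by (simp add: inner_diff inner_commute power2_eq_square)
  then have "(norm (s *\<^sub>R x - z))\<^sup>2 = r\<^sup>2 - 2 * (s * (x \<bullet> z)) + (norm z)\<^sup>2"
    using s(1) by simp
  moreover have "(norm (x - z))\<^sup>2 = (norm x)\<^sup>2 - 2 * (x \<bullet> z) + (norm z)\<^sup>2"
    by (simp add: power2_norm_eq_inner inner_diff inner_commute)
  moreover have "0 \<le> (norm x - r)\<^sup>2"
    by simp
  ultimately have "(norm (s *\<^sub>R x - z))\<^sup>2 \<le> (norm (x - z))\<^sup>2"
    using ip by (simp add: power2_eq_square algebra_simps)
  then show ?thesis
    using False by (simp add: ball_proj_def s_def)
qed (simp add: ball_proj_def)

lemma ball_proj_in_Rn: "x \<in> Rn d \<Longrightarrow> ball_proj r x \<in> Rn d"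
  by (simp add: ball_proj_def subspace_scale[OF subspace_Rn])



section \<open>Projected stochastic gradient descent\<close>

text \<open>A server has no state besides the transcript, so the current iterate is recomputed from
  the last entry, which holds both the previous iterate and the reply to it.\<close>

definition sgd_point :: "real \<Rightarrow> real \<Rightarrow> transcript \<Rightarrow> rvec"
  where "sgd_point R \<eta> h =
    (if h = [] then 0 else case last h of (i, u, v) \<Rightarrow> ball_proj R (u - \<eta> *\<^sub>R v))"

text \<open>The weights stand inside the sum, as in Jensen's inequality. The empty transcript gives
  0, the output of a server that asks nothing.\<close>

definition mean_point :: "transcript \<Rightarrow> rvec"
  where "mean_point h = (\<Sum>k<length h. (1 / real (length h)) *\<^sub>R fst (snd (h ! k)))"

text \<open>
  The first case is never reached in an actual interaction; it makes the server well-defined on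
  transcripts with points outside \<^term>\<open>Rn d\<close>.
\<close>
definition sgd_server :: "nat \<Rightarrow> nat \<Rightarrow> real \<Rightarrow> real \<Rightarrow> nat \<Rightarrow> server"
  where "sgd_server n d R \<eta> T h =
    (if \<exists>(i, u, v)\<in>set h. u \<notin> Rn d \<or> v \<notin> Rn d then return_pmf (Output 0)
     else if length h < T then map_pmf (\<lambda>i. Query i (sgd_point R \<eta> h)) (pmf_of_set {1..n})
     else return_pmf (Output (mean_point h)))"

lemma zero_in_Rn: "0 \<in> Rn d"
  by (rule subspace_0[OF subspace_Rn])

lemma sgd_point_in_Rn:
  assumes "\<And>i u v. (i, u, v) \<in> set h \<Longrightarrow> u \<in> Rn d \<and> v \<in> Rn d"
  shows "sgd_point R \<eta> h \<in> Rn d"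
proof (cases "h = []")
  case False
  obtain i u v where l: "last h = (i, u, v)"
    by (cases "last h")
  then have "u \<in> Rn d \<and> v \<in> Rn d"
    using assms last_in_set[OF False] by metis
  then show ?thesis
    using False l
    by (simp add: sgd_point_def ball_proj_in_Rn subspace_diff[OF subspace_Rn] subspace_scale[OF subspace_Rn])
qed (simp add: sgd_point_def zero_in_Rn)

lemma mean_point_in_Rn:
  assumes "\<And>i u v. (i, u, v) \<in> set h \<Longrightarrow> u \<in> Rn d \<and> v \<in> Rn d"
  shows "mean_point h \<in> Rn d"
  unfolding mean_point_def
proof (intro subspace_sum[OF subspace_Rn] subspace_scale[OF subspace_Rn])
  fix k assume "k \<in> {..<length h}"
  then show "fst (snd (h ! k)) \<in> Rn d"
    using assms nth_mem[of k h] by (cases "h ! k") auto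
qed

lemma server_for_sgd:
  assumes "n \<ge> 1"
  shows "server_for n d (sgd_server n d R \<eta> T)"
  unfolding server_for_def
proof
  fix h
  show "set_pmf (sgd_server n d R \<eta> T h) \<subseteq> {Query i w | i w. i \<in> {1..n} \<and> w \<in> Rn d} \<union> Output ` Rn d"
  proof (cases "\<exists>(i, u, v)\<in>set h. u \<notin> Rn d \<or> v \<notin> Rn d")
    case False
    then have *: "\<And>i u v. (i, u, v) \<in> set h \<Longrightarrow> u \<in> Rn d \<and> v \<in> Rn d"
      by auto
    show ?thesis
      using False assms sgd_point_in_Rn[OF *] mean_point_in_Rn[OF *] by (auto simp: sgd_server_def)
  qed (simp add: sgd_server_def zero_in_Rn)
qed

text \<open>The transcript determines the query point, so only the client is random; the injective
  map from clients to queries carries the uniform distribution over.\<close>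

lemma selects_clients_uniformly_sgd: "selects_clients_uniformly n (sgd_server n d R \<eta> T)"
  unfolding selects_clients_uniformly_def
proof (intro allI ballI)
  fix h w i j
  assume ij: "i \<in> {1..n}" "j \<in> {1..n}"
  define q where "q = (\<lambda>i. Query i (sgd_point R \<eta> h))"
  have inj: "inj q"
    by (auto simp: q_def inj_def)
  have "pmf (map_pmf q (pmf_of_set {1..n})) (Query i w) = pmf (map_pmf q (pmf_of_set {1..n})) (Query j w)"
  proof (cases "w = sgd_point R \<eta> h")
    case True
    then show ?thesis
      using pmf_map_inj'[OF inj, of _ i] pmf_map_inj'[OF inj, of _ j] ij
      by (simp add: q_def[symmetric] q_def[THEN fun_cong, symmetric])
  next
    case False
    then have "Query k w \<notin> set_pmf (map_pmf q (pmf_of_set {1..n}))" for k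
      by (auto simp: q_def)
    then show ?thesis
      by (simp add: set_pmf_iff del: set_map_pmf)
  qed
  then show "pmf (sgd_server n d R \<eta> T h) (Query i w) = pmf (sgd_server n d R \<eta> T h) (Query j w)"
    by (simp add: sgd_server_def q_def)
qed


section \<open>Bounds for a fixed instance and a fixed reply strategy\<close>

locale dlagp =
  fixes n d :: nat and L R \<epsilon> G :: real and l :: "nat \<Rightarrow> rvec \<Rightarrow> real" and wstar :: rvec
    and A :: replies
  assumes n: "n \<ge> 1" and L: "L > 0" and R: "R > 0" and eps: "\<epsilon> \<ge> 0"
    and inst: "R_instance n d L R l wstar"
    and valid: "valid_replies n d \<epsilon> l A"
    and G: "\<And>i. i \<in> {1..n} \<Longrightarrow> norm (gradient d (l i) 0) + L * R + \<epsilon> \<le> G"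
begin

lemma wstar: "wstar \<in> Rn d" "norm wstar \<le> R" "\<And>w. w \<in> Rn d \<Longrightarrow> objective n l wstar \<le> objective n l w"
  using inst
  by (auto simp: R_instance_def least_norm_minimizer_def minimizer_def is_arg_min_linorder)

lemma conv: "i \<in> {1..n} \<Longrightarrow> convex_on (Rn d) (l i)"
  and smooth: "i \<in> {1..n} \<Longrightarrow> L-lipschitz_on (Rn d) (gradient d (l i))"
  using inst by (auto simp: R_instance_def smooth_with_def)

lemma grad: "i \<in> {1..n} \<Longrightarrow> w \<in> Rn d \<Longrightarrow> has_gradient d (l i) w (gradient d (l i) w)"
  using inst by (intro has_gradient_gradient) (auto simp: R_instance_def smooth_with_def)

lemma above_gradient:
  assumes "i \<in> {1..n}" "w \<in> Rn d" "z \<in> Rn d"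
  shows "l i w - l i z \<le> gradient d (l i) w \<bullet> (w - z)"
  using convex_on_above_gradient[OF conv grad, of i w z] assms by (simp add: inner_diff_right)

text \<open>Smoothness carries the bound from the origin to the ball. Hence \<open>G\<close> also
  dominates every valid reply to a query in the ball.\<close>

lemma norm_gradient_le:
  assumes "i \<in> {1..n}" "w \<in> Rn d" "norm w \<le> R"
  shows "norm (gradient d (l i) w) + \<epsilon> \<le> G"
proof -
  have "norm (gradient d (l i) w - gradient d (l i) 0) \<le> L * norm w"
    using lipschitz_onD[OF smooth[OF assms(1)] assms(2) zero_in_Rn] by (simp add: dist_norm)
  also have "\<dots> \<le> L * R"
    using assms(3) L by simp
  finally show ?thesis
    using norm_triangle_sub[of "gradient d (l i) w" "gradient d (l i) 0"] G[OF assms(1)] by linarith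
qed

text \<open>Used with \<open>w\<close> and \<open>z\<close> in both orders, this gives the bounded
  range needed for Hoeffding's lemma.\<close>

lemma gap_le:
  assumes "i \<in> {1..n}" "w \<in> Rn d" "norm w \<le> R" "z \<in> Rn d" "norm z \<le> R"
  shows "l i w - l i z \<le> 2 * R * G"
proof -
  have "l i w - l i z \<le> norm (gradient d (l i) w) * norm (w - z)"
    using above_gradient[OF assms(1,2,4)] norm_cauchy_schwarz order_trans by blast
  also have "\<dots> \<le> G * (2 * R)"
    using norm_gradient_le[OF assms(1-3)] norm_triangle_ineq4[of w z] assms(3,5) eps
    by (intro mult_mono) (use norm_ge_zero[of "gradient d (l i) w"] norm_ge_zero[of "w - z"] in linarith)+
  finally show ?thesis
    by (simp add: mult_ac)
qed

lemma mean_gap: "(\<Sum>i=1..n. l i w - l i wstar) / n = objective n l w - objective n l wstar"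
  by (simp add: objective_def sum_subtractf diff_divide_distrib)

text \<open>On every line through \<open>wstar\<close> the sum of the losses is minimal there, so
  its derivative vanishes.\<close>

lemma sum_gradient_wstar:
  assumes "u \<in> Rn d"
  shows "(\<Sum>i=1..n. gradient d (l i) wstar \<bullet> u) = 0"
proof -
  have "((\<lambda>t. \<Sum>i=1..n. l i (wstar + t *\<^sub>R u)) has_real_derivative (\<Sum>i=1..n. gradient d (l i) wstar \<bullet> u)) (at 0)"
    by (rule DERIV_sum) (use has_gradient_imp_DERIV_line[OF grad] wstar assms in auto)
  moreover have "\<forall>y. \<bar>0 - y\<bar> < (1::real) \<longrightarrow>
      (\<Sum>i=1..n. l i (wstar + 0 *\<^sub>R u)) \<le> (\<Sum>i=1..n. l i (wstar + y *\<^sub>R u))"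
  proof (intro allI impI)
    fix y :: real
    have "wstar + y *\<^sub>R u \<in> Rn d"
      using wstar assms by (auto intro: subspace_add subspace_scale subspace_Rn)
    then show "(\<Sum>i=1..n. l i (wstar + 0 *\<^sub>R u)) \<le> (\<Sum>i=1..n. l i (wstar + y *\<^sub>R u))"
      using wstar(3) n by (fastforce simp: objective_def divide_simps)
  qed
  ultimately show ?thesis
    using DERIV_local_min[of _ _ 0 1] zero_less_one by blast
qed

text \<open>A single client may have a nonzero gradient at \<open>wstar\<close>. Moving each
  gradient from 0 to \<open>wstar\<close> costs at most \<open>L * R\<^sup>2\<close>, and the
  remaining linear terms cancel in the sum.\<close>

lemma objective_0_le: "objective n l 0 - objective n l wstar \<le> L * R\<^sup>2"
proof -
  have "l i 0 - l i wstar \<le> gradient d (l i) wstar \<bullet> (- wstar) + L * R\<^sup>2" if i: "i \<in> {1..n}" for i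
  proof -
    let ?g = "gradient d (l i)"
    have "l i 0 - l i wstar \<le> ?g 0 \<bullet> (0 - wstar)"
      using above_gradient[OF i zero_in_Rn] wstar by blast
    also have "\<dots> = ?g wstar \<bullet> (- wstar) + (?g wstar - ?g 0) \<bullet> wstar"
      by (simp add: inner_diff_left)
    also have "(?g wstar - ?g 0) \<bullet> wstar \<le> norm (?g wstar - ?g 0) * norm wstar"
      by (rule norm_cauchy_schwarz)
    also have "\<dots> \<le> (L * norm wstar) * norm wstar"
      using lipschitz_onD[OF smooth[OF i] wstar(1) zero_in_Rn]
      by (intro mult_right_mono) (auto simp: dist_norm)
    also have "\<dots> = L * (norm wstar)\<^sup>2"
      by (simp add: power2_eq_square)
    also have "\<dots> \<le> L * R\<^sup>2"
      using wstar L by (intro mult_left_mono power_mono) auto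
    finally show ?thesis
      by simp
  qed
  then have "(\<Sum>i=1..n. l i 0 - l i wstar) \<le> (\<Sum>i=1..n. gradient d (l i) wstar \<bullet> (- wstar) + L * R\<^sup>2)"
    by (rule sum_mono)
  also have "\<dots> = real n * (L * R\<^sup>2)"
    unfolding sum.distrib
    using sum_gradient_wstar[of "- wstar"] wstar subspace_neg[OF subspace_Rn] by simp
  finally have "(\<Sum>i=1..n. l i 0 - l i wstar) / n \<le> L * R\<^sup>2"
    using n by (simp add: divide_simps mult_ac)
  then show ?thesis
    by (simp only: mean_gap)
qed

lemma convex_objective: "convex_on (Rn d) (objective n l)"
proof -
  have "convex_on (Rn d) (\<lambda>w. \<Sum>i\<in>I. l i w)" if "finite I" "I \<subseteq> {1..n}" for I
    using that
  proof (induction I rule: finite_induct)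
    case empty
    then show ?case
      by (simp add: convex_on_const subspace_imp_convex[OF subspace_Rn])
  next
    case (insert i I)
    then show ?case
      by (simp add: conv convex_on_add)
  qed
  then show ?thesis
    unfolding objective_def by (intro convex_on_cmul) auto
qed

section \<open>Descent along a transcript\<close>

definition loss_gap :: "transcript \<Rightarrow> real"
  where "loss_gap h = (\<Sum>(i, u, v)\<leftarrow>h. l i u - l i wstar)"

text \<open>Each summand is the conditional mean, over the uniform client, of the matching summand
  of \<open>loss_gap\<close>. Descent controls \<open>loss_gap\<close>, while the quality of the
  output is controlled by \<open>regret\<close>.\<close>

definition regret :: "transcript \<Rightarrow> real"
  where "regret h = (\<Sum>(i, u, v)\<leftarrow>h. objective n l u - objective n l wstar)"

text \<open>The last conjunct is the telescoped descent inequality \<open>\<parallel>w' - w\<^sup>*\<parallel>\<^sup>2 \<le> \<parallel>w - w\<^sup>*\<parallel>\<^sup>2 - 2\<eta> v \<bullet> (w - w\<^sup>*) + \<eta>\<^sup>2 \<parallel>v\<parallel>\<^sup>2\<close>.\<close>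
definition sgd_invariant :: "real \<Rightarrow> transcript \<Rightarrow> bool"
  where "sgd_invariant \<eta> h \<longleftrightarrow>
    (\<forall>(i, u, v)\<in>set h. u \<in> Rn d \<and> v \<in> Rn d) \<and> norm (sgd_point R \<eta> h) \<le> R \<and>
    (norm (sgd_point R \<eta> h - wstar))\<^sup>2 \<le>
      R\<^sup>2 - 2 * \<eta> * loss_gap h + length h * (4 * \<eta> * R * \<epsilon> + \<eta>\<^sup>2 * G\<^sup>2)"

lemma sgd_invariant_Nil: "sgd_invariant \<eta> []"
  using R wstar by (simp add: sgd_invariant_def sgd_point_def loss_gap_def power_mono)

lemma sgd_invariant_imp_Rn: "sgd_invariant \<eta> h \<Longrightarrow> sgd_point R \<eta> h \<in> Rn d"
  by (rule sgd_point_in_Rn) (auto simp: sgd_invariant_def)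

text \<open>This holds for every client and every valid reply; chance enters only when
  \<open>loss_gap\<close> is compared with \<open>regret\<close>.\<close>

lemma sgd_invariant_snoc:
  assumes inv: "sgd_invariant \<eta> h" and i: "i \<in> {1..n}" and \<eta>: "\<eta> > 0"
  shows "sgd_invariant \<eta> (h @ [(i, sgd_point R \<eta> h, A h i (sgd_point R \<eta> h))])"
proof -
  define w where "w = sgd_point R \<eta> h"
  define v where "v = A h i w"
  define g where "g = gradient d (l i) w"
  have w: "w \<in> Rn d" "norm w \<le> R"
    using inv sgd_invariant_imp_Rn by (auto simp: w_def sgd_invariant_def)
  have v: "v \<in> Rn d" "norm (v - g) \<le> \<epsilon>"
    using valid i w by (auto simp: valid_replies_def v_def g_def)
  have next_eq: "sgd_point R \<eta> (h @ [(i, w, v)]) = ball_proj R (w - \<eta> *\<^sub>R v)"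
    by (simp add: sgd_point_def)
  have "norm v \<le> G"
    using norm_triangle_sub[of v g] v(2) norm_gradient_le[OF i w] by (simp add: g_def)
  then have "\<eta>\<^sup>2 * (norm v)\<^sup>2 \<le> \<eta>\<^sup>2 * G\<^sup>2"
    by (intro mult_left_mono power_mono) auto
  \<comment> \<open>Both points lie in the ball, so replacing the gradient by the reply costs at
    most \<epsilon> times the diameter.\<close>
  moreover have "l i w - l i wstar - 2 * R * \<epsilon> \<le> v \<bullet> (w - wstar)"
  proof -
    have "\<bar>(v - g) \<bullet> (w - wstar)\<bar> \<le> norm (v - g) * norm (w - wstar)"
      by (rule Cauchy_Schwarz_ineq2)
    also have "\<dots> \<le> \<epsilon> * (2 * R)"
      using v(2) eps w(2) wstar(2) norm_triangle_ineq4[of w wstar] by (intro mult_mono) auto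
    finally show ?thesis
      using above_gradient[OF i w(1) wstar(1)] by (simp add: g_def inner_diff_left algebra_simps)
  qed
  then have "2 * \<eta> * (l i w - l i wstar - 2 * R * \<epsilon>) \<le> 2 * \<eta> * (v \<bullet> (w - wstar))"
    using \<eta> by (intro mult_left_mono) auto
  then have "2 * \<eta> * (l i w - l i wstar) - 4 * \<eta> * R * \<epsilon> \<le> 2 * \<eta> * (v \<bullet> (w - wstar))"
    by (simp only: right_diff_distrib mult_ac)
  moreover have "(norm (ball_proj R (w - \<eta> *\<^sub>R v) - wstar))\<^sup>2 \<le> (norm (w - \<eta> *\<^sub>R v - wstar))\<^sup>2"
    using wstar by (intro power_mono norm_ball_proj_diff_le) auto
  moreover have "(norm (w - \<eta> *\<^sub>R v - wstar))\<^sup>2 =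
      (norm (w - wstar))\<^sup>2 - 2 * \<eta> * (v \<bullet> (w - wstar)) + \<eta>\<^sup>2 * (norm v)\<^sup>2"
    unfolding power2_norm_eq_inner
    by (simp add: inner_diff inner_commute power2_eq_square algebra_simps)
  moreover have "(norm (w - wstar))\<^sup>2 \<le>
      R\<^sup>2 - 2 * \<eta> * loss_gap h + length h * (4 * \<eta> * R * \<epsilon> + \<eta>\<^sup>2 * G\<^sup>2)"
    using inv by (simp add: sgd_invariant_def w_def)
  ultimately have "(norm (ball_proj R (w - \<eta> *\<^sub>R v) - wstar))\<^sup>2 \<le>
      R\<^sup>2 - 2 * \<eta> * loss_gap h + length h * (4 * \<eta> * R * \<epsilon> + \<eta>\<^sup>2 * G\<^sup>2)
      - 2 * \<eta> * (l i w - l i wstar) + (4 * \<eta> * R * \<epsilon> + \<eta>\<^sup>2 * G\<^sup>2)"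
    by linarith
  then have "(norm (ball_proj R (w - \<eta> *\<^sub>R v) - wstar))\<^sup>2 \<le>
      R\<^sup>2 - 2 * \<eta> * loss_gap (h @ [(i, w, v)]) +
      length (h @ [(i, w, v)]) * (4 * \<eta> * R * \<epsilon> + \<eta>\<^sup>2 * G\<^sup>2)"
    by (simp add: loss_gap_def algebra_simps)
  then have "sgd_invariant \<eta> (h @ [(i, w, v)])"
    unfolding sgd_invariant_def next_eq
    using inv w v R norm_ball_proj_le[of R "w - \<eta> *\<^sub>R v"] by (auto simp: sgd_invariant_def)
  then show ?thesis
    by (simp add: w_def v_def)
qed

lemma loss_gap_le:
  assumes "sgd_invariant \<eta> h" "\<eta> > 0"
  shows "loss_gap h \<le> R\<^sup>2 / (2 * \<eta>) + length h * (2 * R * \<epsilon> + \<eta> * G\<^sup>2 / 2)"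
proof -
  have "0 \<le> (norm (sgd_point R \<eta> h - wstar))\<^sup>2"
    by simp
  also have "\<dots> \<le> R\<^sup>2 - 2 * \<eta> * loss_gap h + length h * (4 * \<eta> * R * \<epsilon> + \<eta>\<^sup>2 * G\<^sup>2)"
    using assms by (simp add: sgd_invariant_def)
  finally have "2 * \<eta> * loss_gap h \<le> R\<^sup>2 + length h * (4 * \<eta> * R * \<epsilon> + \<eta>\<^sup>2 * G\<^sup>2)"
    by simp
  then have "loss_gap h \<le> (R\<^sup>2 + length h * (4 * \<eta> * R * \<epsilon> + \<eta>\<^sup>2 * G\<^sup>2)) / (2 * \<eta>)"
    using assms(2) by (simp add: pos_le_divide_eq mult.commute)
  also have "\<dots> = R\<^sup>2 / (2 * \<eta>) + length h * (2 * R * \<epsilon> + \<eta> * G\<^sup>2 / 2)"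
    using assms(2) by (simp add: field_simps power2_eq_square)
  finally show ?thesis .
qed

text \<open>Jensen's inequality for the uniform average of the query points.\<close>

lemma objective_mean_point_le:
  assumes "\<And>i u v. (i, u, v) \<in> set h \<Longrightarrow> u \<in> Rn d" "h \<noteq> []"
  shows "length h * (objective n l (mean_point h) - objective n l wstar) \<le> regret h"
proof -
  have "objective n l (mean_point h) \<le>
      (\<Sum>k<length h. (1 / real (length h)) * objective n l (fst (snd (h ! k))))"
    unfolding mean_point_def
  proof (rule convex_on_sum[OF _ _ convex_objective])
    fix k assume "k \<in> {..<length h}"
    then show "fst (snd (h ! k)) \<in> Rn d"
      using assms nth_mem[of k h] by (cases "h ! k") auto
  qed (use assms in auto)
  also have "\<dots> = (\<Sum>k<length h. objective n l (fst (snd (h ! k)))) / length h"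
    by (simp add: sum_divide_distrib)
  finally have "length h * objective n l (mean_point h) \<le> (\<Sum>k<length h. objective n l (fst (snd (h ! k))))"
    using assms(2) by (simp add: field_simps)
  moreover have "regret h = (\<Sum>k<length h. objective n l (fst (snd (h ! k))) - objective n l wstar)"
    by (simp add: regret_def sum_list_sum_nth atLeast0LessThan case_prod_unfold)
  ultimately show ?thesis
    by (simp add: sum_subtractf algebra_simps)
qed

section \<open>Exponential moments and the failure probability\<close>

lemma nn_integral_exp_client_deviation_le:
  assumes "w \<in> Rn d" "norm w \<le> R" "\<theta> > 0"
  shows "(\<integral>\<^sup>+i. ennreal (exp (\<theta> * ((objective n l w - objective n l wstar) - (l i w - l i wstar))))
      \<partial>measure_pmf (pmf_of_set {1..n})) \<le> ennreal (exp (2 * \<theta>\<^sup>2 * R\<^sup>2 * G\<^sup>2))"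
proof -
  have fin: "finite {1..n}" "{1..n} \<noteq> {}"
    using n by auto
  \<comment> \<open>Hoeffding's lemma is applied to the negated gap, whose range has length
    \<open>4 * R * G\<close>; this produces the factor 2 in the exponent.\<close>
  interpret interval_bounded_random_variable "measure_pmf (pmf_of_set {1..n})"
    "\<lambda>i. l i wstar - l i w" "- (2 * R * G)" "2 * R * G"
  proof unfold_locales
    show "AE i in measure_pmf (pmf_of_set {1..n}). l i wstar - l i w \<in> {- (2 * R * G)..2 * R * G}"
      using gap_le[of _ w wstar] gap_le[of _ wstar w] assms wstar fin
      by (fastforce simp: AE_measure_pmf_iff)
  qed auto
  have "measure_pmf.expectation (pmf_of_set {1..n}) (\<lambda>i. l i wstar - l i w) =
      - (objective n l w - objective n l wstar)"
    unfolding integral_pmf_of_set[OF fin(2,1)] mean_gap[symmetric]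
    by (simp add: sum_subtractf diff_divide_distrib)
  then have dev: "(objective n l w - objective n l wstar) - (l i w - l i wstar) =
      l i wstar - l i w - measure_pmf.expectation (pmf_of_set {1..n}) (\<lambda>i. l i wstar - l i w)" for i
    by simp
  have var: "\<theta>\<^sup>2 * (2 * R * G - - (2 * R * G))\<^sup>2 / 8 = 2 * \<theta>\<^sup>2 * R\<^sup>2 * G\<^sup>2"
    by (simp add: power2_eq_square)
  show ?thesis
    unfolding dev by (rule Hoeffdings_lemma_nn_integral[OF assms(3), unfolded var])
qed

definition solutions :: "real \<Rightarrow> rvec option set"
  where "solutions \<tau> = {r. \<exists>w. r = Some w \<and> w \<in> Rn d \<and> objective n l w - objective n l wstar \<le> \<tau>}"

text \<open>
  Markov's inequality for \<open>exp (\<theta> * (regret h - loss_gap h))\<close>, which is a supermartingale up to the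
  factor \<open>exp (2 \<theta>\<^sup>2 R\<^sup>2 G\<^sup>2)\<close> per query.
\<close>
lemma run_sgd_failure:
  assumes \<eta>: "\<eta> > 0" and \<theta>: "\<theta> > 0" and T: "T \<ge> 1"
    and s: "s = T * (\<tau> - (2 * R * \<epsilon> + \<eta> * G\<^sup>2 / 2)) - R\<^sup>2 / (2 * \<eta>)"
    and inv: "sgd_invariant \<eta> h" and k: "length h + k = T"
  shows "None \<notin> set_pmf (run (sgd_server n d R \<eta> T) A k h) \<and>
    emeasure (measure_pmf (run (sgd_server n d R \<eta> T) A k h)) (- solutions \<tau>)
      \<le> ennreal (exp (\<theta> * (regret h - loss_gap h - s) + k * (2 * \<theta>\<^sup>2 * R\<^sup>2 * G\<^sup>2)))"
  using inv k
proof (induction k arbitrary: h)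
  case 0
  then have h: "length h = T" "\<And>i u v. (i, u, v) \<in> set h \<Longrightarrow> u \<in> Rn d \<and> v \<in> Rn d" "h \<noteq> []"
    using T by (auto simp: sgd_invariant_def)
  have server: "sgd_server n d R \<eta> T h = return_pmf (Output (mean_point h))"
    using h by (auto simp: sgd_server_def)
  \<comment> \<open>\<open>s\<close> is the deviation that a failure forces:
    \<open>T * \<tau>\<close> less the deterministic bound on \<open>loss_gap\<close>. So the
    exponential dominates the indicator of failure.\<close>
  have "1 \<le> exp (\<theta> * (regret h - loss_gap h - s))" if "Some (mean_point h) \<notin> solutions \<tau>"
  proof -
    have "\<tau> < objective n l (mean_point h) - objective n l wstar"
      using that mean_point_in_Rn[of h d] h by (auto simp: solutions_def)
    then have "T * \<tau> \<le> T * (objective n l (mean_point h) - objective n l wstar)"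
      by (intro mult_left_mono) auto
    also have "\<dots> \<le> regret h"
      using objective_mean_point_le[of h] h by auto
    finally have "s \<le> regret h - loss_gap h"
      using loss_gap_le[OF "0.prems"(1) \<eta>] h(1) by (simp add: s algebra_simps)
    then show ?thesis
      using \<theta> by simp
  qed
  then show ?case
    by (auto simp: server indicator_def ennreal_ge_1 simp flip: ennreal_1)
next
  case (Suc k)
  define w where "w = sgd_point R \<eta> h"
  define e where "e = 2 * \<theta>\<^sup>2 * R\<^sup>2 * G\<^sup>2"
  define dev where "dev i = (objective n l w - objective n l wstar) - (l i w - l i wstar)" for i
  define h' where "h' i = h @ [(i, w, A h i w)]" for i
  let ?S = "sgd_server n d R \<eta> T" and ?P = "pmf_of_set {1..n}"
  have P: "set_pmf ?P = {1..n}"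
    using n by (subst set_pmf_of_set) auto
  have "\<not> (\<exists>(i, u, v)\<in>set h. u \<notin> Rn d \<or> v \<notin> Rn d)"
    using Suc.prems(1) by (auto simp: sgd_invariant_def)
  then have "?S h = map_pmf (\<lambda>i. Query i w) ?P"
    using Suc.prems(2) by (auto simp: sgd_server_def w_def)
  then have run: "run ?S A (Suc k) h = bind_pmf ?P (\<lambda>i. run ?S A k (h' i))"
    by (simp add: bind_map_pmf h'_def)
  \<comment> \<open>The new summands of \<open>regret\<close> and \<open>loss_gap\<close> do not
    involve the reply, so an adversary who sees the client cannot bias the factor
    \<open>exp (\<theta> * dev i)\<close>.\<close>
  have step: "None \<notin> set_pmf (run ?S A k (h' i)) \<and>
      emeasure (measure_pmf (run ?S A k (h' i))) (- solutions \<tau>)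
        \<le> ennreal (exp (\<theta> * (regret h - loss_gap h - s) + k * e)) * ennreal (exp (\<theta> * dev i))"
    if i: "i \<in> {1..n}" for i
  proof -
    have "regret (h' i) - loss_gap (h' i) - s = (regret h - loss_gap h - s) + dev i"
      by (simp add: regret_def loss_gap_def h'_def dev_def)
    then have "exp (\<theta> * (regret (h' i) - loss_gap (h' i) - s) + k * e) =
        exp (\<theta> * (regret h - loss_gap h - s) + k * e) * exp (\<theta> * dev i)"
      by (simp only: distrib_left exp_add mult_ac)
    moreover have "sgd_invariant \<eta> (h' i)"
      using sgd_invariant_snoc[OF Suc.prems(1) i \<eta>] by (simp add: h'_def w_def)
    ultimately show ?thesis
      using Suc.IH[of "h' i"] Suc.prems(2) by (simp add: h'_def e_def ennreal_mult)
  qed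
  have "emeasure (measure_pmf (run ?S A (Suc k) h)) (- solutions \<tau>) \<le>
      (\<integral>\<^sup>+i. ennreal (exp (\<theta> * (regret h - loss_gap h - s) + k * e)) * ennreal (exp (\<theta> * dev i)) \<partial>measure_pmf ?P)"
    unfolding run emeasure_bind_pmf
    by (intro nn_integral_mono_AE) (use step P in \<open>auto simp: AE_measure_pmf_iff\<close>)
  also have "\<dots> = ennreal (exp (\<theta> * (regret h - loss_gap h - s) + k * e)) *
      (\<integral>\<^sup>+i. ennreal (exp (\<theta> * dev i)) \<partial>measure_pmf ?P)"
    by (rule nn_integral_cmult) auto
  also have "\<dots> \<le> ennreal (exp (\<theta> * (regret h - loss_gap h - s) + k * e)) * ennreal (exp e)"
    unfolding dev_def e_def
    by (intro mult_left_mono nn_integral_exp_client_deviation_le)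
      (use Suc.prems(1) sgd_invariant_imp_Rn \<theta> in \<open>auto simp: w_def sgd_invariant_def\<close>)
  also have "\<dots> = ennreal (exp (\<theta> * (regret h - loss_gap h - s) + Suc k * e))"
    by (simp add: algebra_simps flip: exp_add ennreal_mult)
  finally show ?case
    using step P unfolding run e_def[symmetric] by auto
qed

lemma run_sgd_success:
  assumes \<eta>: "\<eta> > 0" and T: "T \<ge> 1" and G_pos: "G > 0" and \<tau>: "\<tau> > 0" and \<delta>: "0 < \<delta>"
    and \<eta>_def: "\<eta> = \<tau> / (5 * G\<^sup>2)" and eR: "5 * (\<epsilon> * R) \<le> \<tau>"
    and T_ge: "real T \<ge> 50 * (R * G / \<tau>)\<^sup>2 * (1 + ln (1 / \<delta>))" "real T \<ge> 50 * (R * G / \<tau>)\<^sup>2"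
  shows "issues_at_most (sgd_server n d R \<eta> T) A T"
    and "measure_pmf.prob (run (sgd_server n d R \<eta> T) A T []) (solutions \<tau>) \<ge> 1 - \<delta>"
proof -
  define p where "p = run (sgd_server n d R \<eta> T) A T []"
  define q where "q = (R * G / \<tau>)\<^sup>2"
  \<comment> \<open>This minimizes \<open>- (\<theta> * s) + T * (2 * \<theta>\<^sup>2 * R\<^sup>2 *
    G\<^sup>2)\<close> when \<open>s\<close> is replaced by its lower bound
    \<open>T * (2 / 5 * \<tau>)\<close>.\<close>
  define \<theta> where "\<theta> = \<tau> / (10 * R\<^sup>2 * G\<^sup>2)"
  define s where "s = T * (\<tau> - (2 * R * \<epsilon> + \<eta> * G\<^sup>2 / 2)) - R\<^sup>2 / (2 * \<eta>)"
  have q: "q > 0"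
    using R G_pos \<tau> by (simp add: q_def)
  have \<theta>: "\<theta> > 0"
    using R G_pos \<tau> by (simp add: \<theta>_def)
  have "\<theta> * \<tau> = 1 / (10 * q)" "2 * \<theta>\<^sup>2 * R\<^sup>2 * G\<^sup>2 = 1 / (50 * q)"
    using R G_pos \<tau> by (simp_all add: \<theta>_def q_def field_simps power2_eq_square)
  note \<theta>_eqs = this
  have "R\<^sup>2 / (2 * \<eta>) = 5 / 2 * q * \<tau>"
    using R G_pos \<tau> by (simp add: \<eta>_def q_def field_simps power2_eq_square)
  also have "\<dots> \<le> T * \<tau> / 20"
    using mult_right_mono[OF T_ge(2), of \<tau>] \<tau> by (simp add: q_def)
  finally have "R\<^sup>2 / (2 * \<eta>) \<le> T * \<tau> / 20" .
  moreover have "\<eta> * G\<^sup>2 / 2 = \<tau> / 10"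
    using G_pos by (simp add: \<eta>_def)
  moreover have "T * (2 * R * \<epsilon>) \<le> T * (2 / 5 * \<tau>)"
    using eR by (intro mult_left_mono) (auto simp: mult.commute[of R])
  moreover have "s = T * \<tau> - T * (2 * R * \<epsilon>) - T * (\<eta> * G\<^sup>2 / 2) - R\<^sup>2 / (2 * \<eta>)"
    by (simp add: s_def right_diff_distrib distrib_left)
  ultimately have "s = T * \<tau> - T * (2 * R * \<epsilon>) - T * (\<tau> / 10) - R\<^sup>2 / (2 * \<eta>)"
    "R\<^sup>2 / (2 * \<eta>) \<le> T * \<tau> / 20" "T * (2 * R * \<epsilon>) \<le> T * (2 / 5 * \<tau>)"
    by simp_all
  moreover have "0 \<le> T * \<tau>"
    using \<tau> by simp
  \<comment> \<open>Per query, the start costs \<tau>/20, the step size \<tau>/10 and the reply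
    errors 2\<tau>/5, which leaves more than 2\<tau>/5.\<close>
  ultimately have "s \<ge> T * (2 / 5 * \<tau>)"
    by linarith
  then have "\<theta> * s \<ge> \<theta> * (T * (2 / 5 * \<tau>))"
    using \<theta> by simp
  also have "\<theta> * (T * (2 / 5 * \<tau>)) = 2 / 5 * T * (\<theta> * \<tau>)"
    by (simp add: mult_ac)
  finally have "\<theta> * s \<ge> T / (25 * q)"
    by (simp add: \<theta>_eqs)
  moreover have "1 + ln (1 / \<delta>) \<le> T / (50 * q)"
    using T_ge(1) q unfolding q_def[symmetric] by (simp only: pos_le_divide_eq mult_pos_pos zero_less_numeral mult_ac)
  moreover have "T / (25 * q) = 2 * (T * (1 / (50 * q)))" "T / (50 * q) = T * (1 / (50 * q))"
    by simp_all
  moreover have "ln (1 / \<delta>) = - ln \<delta>"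
    using \<delta> by (simp add: ln_div)
  ultimately have "- (\<theta> * s) + T * (1 / (50 * q)) \<le> ln \<delta>"
    by linarith
  then have exp_le: "exp (- (\<theta> * s) + T * (1 / (50 * q))) \<le> \<delta>"
    using \<delta> by (simp add: ln_ge_iff)
  have bound: "None \<notin> set_pmf p \<and>
      emeasure (measure_pmf p) (- solutions \<tau>) \<le> ennreal (exp (- (\<theta> * s) + T * (1 / (50 * q))))"
    using run_sgd_failure[OF \<eta> \<theta> T s_def sgd_invariant_Nil, of T]
    unfolding p_def[symmetric] \<theta>_eqs(2) by (simp add: regret_def loss_gap_def)
  then show "issues_at_most (sgd_server n d R \<eta> T) A T"
    by (simp add: issues_at_most_def p_def)
  have "ennreal (measure_pmf.prob p (- solutions \<tau>)) \<le> ennreal \<delta>"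
    using bound exp_le by (auto simp: measure_pmf.emeasure_eq_measure intro: order_trans ennreal_leI)
  then have "measure_pmf.prob p (- solutions \<tau>) \<le> \<delta>"
    using \<delta> by simp
  then show "measure_pmf.prob (run (sgd_server n d R \<eta> T) A T []) (solutions \<tau>) \<ge> 1 - \<delta>"
    using measure_pmf.prob_compl[of "solutions \<tau>" p] by (simp add: p_def Compl_eq_Diff_UNIV)
qed

end


section \<open>Choice of parameters and the query budget\<close>

theorem mainTheorem3:
  fixes c :: real
  assumes "c > 5"
  shows "\<exists>C a :: real. C > 0 \<and> a > 0 \<and>
    (\<forall>(n::nat) (d::nat) (L::real) (R::real) (\<epsilon>::real) (\<tau>::real) (B\<^sub>0::real) (\<delta>::real).
      n \<ge> 1 \<longrightarrow> d \<ge> 1 \<longrightarrow> L > 0 \<longrightarrow> R > 0 \<longrightarrow> \<epsilon> \<ge> 0 \<longrightarrow> \<tau> > 0 \<longrightarrow> B\<^sub>0 \<ge> 0 \<longrightarrow>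
      0 < \<delta> \<longrightarrow> \<delta> < 1 \<longrightarrow> \<tau> \<ge> c * \<epsilon> * R \<longrightarrow>
      (\<exists>S. server_for n d S \<and> selects_clients_uniformly n S \<and>
        (\<forall>l wstar A.
          R_instance n d L R l wstar \<longrightarrow>
          Max ((\<lambda>i. norm (gradient d (l i) 0)) ` {1..n}) = B\<^sub>0 \<longrightarrow>
          valid_replies n d \<epsilon> l A \<longrightarrow>
          (\<exists>k::nat.
            real k \<le> C * (L * R ^ 4 * (B\<^sub>0 + L * R)\<^sup>2 / \<tau> ^ 3) *
                     ln (2 + L + R + 1 / \<tau> + 1 / \<delta>) powr a \<and>
            issues_at_most S A k \<and>
            measure_pmf.prob (run S A k [])
              {r. \<exists>w. r = Some w \<and> w \<in> Rn d \<and>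
                       objective n l w - objective n l wstar \<le> \<tau>} \<ge> 1 - \<delta>))))"
\<comment> \<open>400 bounds the number of steps before rounding and 1 pays for rounding up;
  \<open>c\<close> enters only through \<open>5 * (\<epsilon> * R) \<le> \<tau>\<close>.\<close>
proof (rule exI[of _ 401], rule exI[of _ 1], intro conjI allI impI)
  fix n d :: nat and L R \<epsilon> \<tau> B\<^sub>0 \<delta> :: real
  assume n: "n \<ge> 1" and L: "L > 0" and R: "R > 0" and eps: "\<epsilon> \<ge> 0" and \<tau>: "\<tau> > 0" and B: "B\<^sub>0 \<ge> 0"
    and \<delta>: "0 < \<delta>" "\<delta> < 1" and \<tau>_ge: "\<tau> \<ge> c * \<epsilon> * R"
  have "5 * (\<epsilon> * R) \<le> c * (\<epsilon> * R)"
    using assms eps R by (intro mult_right_mono) auto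
  with \<tau>_ge have eR: "5 * (\<epsilon> * R) \<le> \<tau>"
    by (simp add: mult.assoc)
  define \<Lambda> where "\<Lambda> = ln (2 + L + R + 1 / \<tau> + 1 / \<delta>)"
  \<comment> \<open>The claimed budget is a constant times \<open>x * q * \<Lambda>\<close>.\<close>
  define x where "x = L * R\<^sup>2 / \<tau>"
  define q where "q = (R * (B\<^sub>0 + L * R) / \<tau>)\<^sup>2"
  define G where "G = 2 * (B\<^sub>0 + L * R)"
  define \<eta> where "\<eta> = \<tau> / (5 * G\<^sup>2)"
  \<comment> \<open>For \<open>x \<le> 1\<close> the budget may be below one query, so none is made.
    The test uses only parameters known to the server.\<close>
  define T where "T = (if x \<le> 1 then 0 else nat \<lceil>50 * (R * G / \<tau>)\<^sup>2 * (1 + ln (1 / \<delta>))\<rceil>)"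
  define S where "S = sgd_server n d R \<eta> T"
  have budget: "401 * (L * R ^ 4 * (B\<^sub>0 + L * R)\<^sup>2 / \<tau> ^ 3) * \<Lambda> powr 1 = 401 * (x * q) * \<Lambda>"
    if "\<Lambda> > 0"
    using that
    by (simp add: x_def q_def power_divide power_mult_distrib power2_eq_square power3_eq_cube
        power4_eq_xxxx mult_ac)
  have "1 / \<tau> > 0" "1 / \<delta> > 1"
    using \<tau> \<delta> by simp_all
  then have sum_ge: "2 + L + R + 1 / \<tau> + 1 / \<delta> \<ge> 3" "2 + L + R + 1 / \<tau> + 1 / \<delta> \<ge> 1 / \<delta>"
    using L R by linarith+
  \<comment> \<open>The summand 2 together with 1/\<delta> exceeds 3, hence e. This lets \<Lambda>
    absorb additive constants.\<close>
  have "\<Lambda> \<ge> 1"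
  proof -
    have "exp 1 \<le> 2 + L + R + 1 / \<tau> + 1 / \<delta>"
      using exp_le sum_ge by linarith
    then show ?thesis
      unfolding \<Lambda>_def by (subst ln_ge_iff) (use sum_ge in auto)
  qed
  have \<Lambda>_ge: "ln (1 / \<delta>) \<le> \<Lambda>"
    unfolding \<Lambda>_def by (rule ln_mono) (use \<delta> sum_ge in auto)
  have ln_nonneg: "0 \<le> ln (1 / \<delta>)"
    using \<delta> by simp
  have LR: "L * R > 0"
    using L R by simp
  have G_pos: "G > 0"
    using B LR by (simp add: G_def)
  have "x > 0"
    using L R \<tau> by (simp add: x_def)
  have "T \<le> 401 * (x * q) * \<Lambda>"
  proof (cases "x \<le> 1")
    case True
    then show ?thesis
      using \<open>x > 0\<close> \<open>\<Lambda> \<ge> 1\<close> by (simp add: T_def q_def)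
  next
    case False
    \<comment> \<open>As \<open>x\<close> exceeds 1, so does the base of the square
      \<open>q\<close>; thus \<open>q * \<Lambda>\<close> can absorb the rounding.\<close>
    have "x \<le> R * (B\<^sub>0 + L * R) / \<tau>"
      using R B \<tau> by (simp add: x_def divide_simps power2_eq_square algebra_simps)
    then have "1 \<le> q"
      using False unfolding q_def by (intro one_le_power) linarith
    have "R * G / \<tau> = 2 * (R * (B\<^sub>0 + L * R) / \<tau>)"
      unfolding G_def by (simp only: mult_ac times_divide_eq_right)
    then have "(R * G / \<tau>)\<^sup>2 = 4 * q"
      unfolding q_def by (simp only: power_mult_distrib) simp
    then have "T \<le> 200 * q * (1 + ln (1 / \<delta>)) + 1"
      using False \<open>1 \<le> q\<close> ln_nonneg of_nat_ceiling[of "200 * q * (1 + ln (1 / \<delta>))"]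
        of_int_ceiling_le_add_one[of "200 * q * (1 + ln (1 / \<delta>))"]
      by (simp add: T_def)
    also have "\<dots> \<le> 200 * q * (2 * \<Lambda>) + 1 * 1"
      using \<Lambda>_ge \<open>\<Lambda> \<ge> 1\<close> \<open>1 \<le> q\<close> by (intro add_mono mult_left_mono) auto
    also have "\<dots> \<le> 200 * q * (2 * \<Lambda>) + q * \<Lambda>"
      using \<open>\<Lambda> \<ge> 1\<close> \<open>1 \<le> q\<close> by (intro add_left_mono mult_mono) auto
    also have "\<dots> = 401 * (1 * q) * \<Lambda>"
      by simp
    also have "\<dots> \<le> 401 * (x * q) * \<Lambda>"
      using False \<open>\<Lambda> \<ge> 1\<close> \<open>1 \<le> q\<close> by (intro mult_right_mono mult_left_mono) auto
    finally show ?thesis .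
  qed
  then have budget_ok: "T \<le> 401 * (L * R ^ 4 * (B\<^sub>0 + L * R)\<^sup>2 / \<tau> ^ 3) * \<Lambda> powr 1"
    using budget \<open>\<Lambda> \<ge> 1\<close> by simp
  have success: "issues_at_most S A T \<and> measure_pmf.prob (run S A T [])
      {r. \<exists>w. r = Some w \<and> w \<in> Rn d \<and> objective n l w - objective n l wstar \<le> \<tau>} \<ge> 1 - \<delta>"
    if inst: "R_instance n d L R l wstar"
      and Max: "Max ((\<lambda>i. norm (gradient d (l i) 0)) ` {1..n}) = B\<^sub>0"
      and valid: "valid_replies n d \<epsilon> l A" for l wstar A
  proof -
    have grad_0: "norm (gradient d (l i) 0) \<le> B\<^sub>0" if "i \<in> {1..n}" for i
      using that Max by (metis Max_ge finite_atLeastAtMost finite_imageI imageI)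
    show ?thesis
    proof (cases "x \<le> 1")
      case True
      \<comment> \<open>Here \<epsilon> may exceed \<open>L * R\<close>, so the bound contains
        \<epsilon> explicitly instead of being the server's \<open>G\<close>.\<close>
      interpret dlagp n d L R \<epsilon> "B\<^sub>0 + L * R + \<epsilon>" l wstar A
        by unfold_locales (use n L R eps inst valid grad_0 in auto)
      have "L * R\<^sup>2 \<le> \<tau>"
        using True \<tau> by (simp add: x_def)
      with objective_0_le have "objective n l 0 - objective n l wstar \<le> \<tau>"
        by linarith
      moreover have "run S A T [] = return_pmf (Some 0)"
        using True by (simp add: S_def T_def sgd_server_def mean_point_def)
      ultimately show ?thesis
        using \<delta> zero_in_Rn by (simp add: issues_at_most_def)
    next
      case False
      have "\<tau> \<le> (L * R) * R"
        using False \<tau> by (simp add: x_def power2_eq_square mult_ac)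
      \<comment> \<open>Comparing \<epsilon> with \<open>L * R\<close> is what allows the server's
        \<open>G\<close> to be free of \<epsilon>.\<close>
      with eR have "\<epsilon> * R \<le> (L * R) * R"
        using mult_nonneg_nonneg[OF eps, of R] R by linarith
      then have "\<epsilon> \<le> L * R"
        using R by simp
      then interpret dlagp n d L R \<epsilon> G l wstar A
      proof unfold_locales
        fix i assume "i \<in> {1..n}"
        then have "norm (gradient d (l i) 0) + L * R + \<epsilon> \<le> B\<^sub>0 + L * R + L * R"
          using grad_0 \<open>\<epsilon> \<le> L * R\<close> by (intro add_mono) auto
        also have "\<dots> \<le> G"
          using B by (simp add: G_def)
        finally show "norm (gradient d (l i) 0) + L * R + \<epsilon> \<le> G" .
      qed (use n L R eps inst valid in auto)
      have RG: "(R * G / \<tau>)\<^sup>2 > 0"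
        using R G_pos \<tau> by simp
      then have pos: "50 * (R * G / \<tau>)\<^sup>2 * (1 + ln (1 / \<delta>)) > 0"
        using ln_nonneg by (intro mult_pos_pos) auto
      have T_ge: "real T \<ge> 50 * (R * G / \<tau>)\<^sup>2 * (1 + ln (1 / \<delta>))"
        using False by (simp add: T_def of_nat_ceiling)
      then have "T \<ge> 1"
        using pos by (cases T) auto
      have "50 * (R * G / \<tau>)\<^sup>2 * 1 \<le> 50 * (R * G / \<tau>)\<^sup>2 * (1 + ln (1 / \<delta>))"
        using ln_nonneg by (intro mult_left_mono) auto
      with T_ge have T_ge': "real T \<ge> 50 * (R * G / \<tau>)\<^sup>2"
        by simp
      have "\<eta> > 0"
        using \<tau> G_pos by (simp add: \<eta>_def)
      from run_sgd_success[OF this \<open>T \<ge> 1\<close> G_pos \<tau> \<delta>(1) \<eta>_def eR T_ge T_ge']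
      show ?thesis
        by (simp add: S_def solutions_def)
    qed
  qed
  show "\<exists>S. server_for n d S \<and> selects_clients_uniformly n S \<and>
        (\<forall>l wstar A.
          R_instance n d L R l wstar \<longrightarrow>
          Max ((\<lambda>i. norm (gradient d (l i) 0)) ` {1..n}) = B\<^sub>0 \<longrightarrow>
          valid_replies n d \<epsilon> l A \<longrightarrow>
          (\<exists>k::nat.
            real k \<le> 401 * (L * R ^ 4 * (B\<^sub>0 + L * R)\<^sup>2 / \<tau> ^ 3) *
                     ln (2 + L + R + 1 / \<tau> + 1 / \<delta>) powr 1 \<and>
            issues_at_most S A k \<and>
            measure_pmf.prob (run S A k [])
              {r. \<exists>w. r = Some w \<and> w \<in> Rn d \<and>
                       objective n l w - objective n l wstar \<le> \<tau>} \<ge> 1 - \<delta>))"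
    unfolding \<Lambda>_def[symmetric]
  proof (intro exI[of _ S] exI[of _ T] conjI allI impI)
    show "server_for n d S" "selects_clients_uniformly n S"
      by (simp_all add: S_def server_for_sgd[OF n] selects_clients_uniformly_sgd)
    fix l wstar A
    assume inst: "R_instance n d L R l wstar"
      and Max: "Max ((\<lambda>i. norm (gradient d (l i) 0)) ` {1..n}) = B\<^sub>0"
      and valid: "valid_replies n d \<epsilon> l A"
    show "T \<le> 401 * (L * R ^ 4 * (B\<^sub>0 + L * R)\<^sup>2 / \<tau> ^ 3) * \<Lambda> powr 1"
      by (rule budget_ok)
    show "issues_at_most S A T"
      by (rule success[OF inst Max valid, THEN conjunct1])
    show "1 - \<delta> \<le> measure_pmf.prob (run S A T [])
        {r. \<exists>w. r = Some w \<and> w \<in> Rn d \<and> objective n l w - objective n l wstar \<le> \<tau>}"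
      by (rule success[OF inst Max valid, THEN conjunct2])
  qed
qed auto

end
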